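(* For every $0\le p<1$ there is a constant $C_p>0$ such that for every closed, constant speed curve $\gamma:\mathbb T^1\to\mathbb R^3$ with finite distortion and finite bending energy, $$\bar c_p(\gamma):=\frac1{4\pi}\int_{\mathcal S^2}\ \sum_{(x,z)\in C_\gamma(\sigma)}\left(\frac{\mathrm{len}(\gamma)}{D_\gamma(\gamma(x),\gamma(x+z))}\right)^p d\sigma\ \le\ C_p\,\bar\kappa_2^2(\gamma)\,\delta_\infty^3(\gamma).$$
   Context: $\mathbb T^1$ is $[-\pi,\pi]$ with endpoints identified. $\mathrm{len}(\gamma)=\int_{\mathbb T^1}|\gamma'|dx$, and constant speed means $|\gamma'|\equiv\mathrm{len}(\gamma)/2\pi$. $D_\gamma$ denotes the arc-length distance along the closed curve $\gamma$. The distortion $\delta_\infty(\gamma)$ is the supremum over distinct points of the curve of the ratio of arc-length distance along the curve to Euclidean distance. With $\kappa_\gamma$ the pointwise curvature (for constant speed curves $\kappa_\gamma(x)=4\pi^2|\gamma''(x)|/\mathrm{len}(\gamma)^2$), $$\bar\kappa_2(\gamma)=\left(\frac{\mathrm{len}(\gamma)}{2\pi}\right)^{\frac12}\left(\frac1{2\pi}\int_{\mathbb T^1}\kappa_\gamma^2(x)|\gamma'(x)|\,dx\right)^{\frac12},$$ whose square is the scale-invariant bending energy. $\mathcal S^2$ is the unit sphere with surface measure, and $C_\gamma(\sigma)=\{(x,z)\in\mathbb T^1\times\mathbb T^1:(P_\sigma\gamma)(x)=(P_\sigma\gamma)(x+z),\ z\ne0\}$, with $P_\sigma\gamma=\gamma-\langle\gamma,\sigma\rangle\sigma$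 the orthogonal projection onto $\sigma^\perp$. *)

theory Defs
  imports "HOL-Analysis.Analysis"
begin

(* A map on the circle [-pi, pi] with endpoints identified is a 2*pi-periodic function on the
   reals; the points of the circle are represented by the fundamental domain circle_dom. *)

definition closed_curve :: "(real \<Rightarrow> real^3) \<Rightarrow> bool" where
  "closed_curve \<gamma> \<longleftrightarrow> (\<forall>x. \<gamma> (x + 2 * pi) = \<gamma> x)"

definition circle_dom :: "real set" where
  "circle_dom = {-pi..<pi}"

definition deriv1 :: "(real \<Rightarrow> real^3) \<Rightarrow> real \<Rightarrow> real^3" where
  "deriv1 \<gamma> x = vector_derivative \<gamma> (at x)"

definition deriv2 :: "(real \<Rightarrow> real^3) \<Rightarrow> real \<Rightarrow> real^3" where
  "deriv2 \<gamma> = deriv1 (deriv1 \<gamma>)"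

definition curve_len :: "(real \<Rightarrow> real^3) \<Rightarrow> real" where
  "curve_len \<gamma> = integral {-pi..pi} (\<lambda>x. norm (deriv1 \<gamma> x))"

definition constant_speed :: "(real \<Rightarrow> real^3) \<Rightarrow> bool" where
  "constant_speed \<gamma> \<longleftrightarrow> (\<forall>x. norm (deriv1 \<gamma> x) = curve_len \<gamma> / (2 * pi))"

(* Arc-length distance between the curve points with parameters x and y: the arcs between them
   are parametrised by the intervals between x and the representatives y + 2*pi*k of y.  It is a
   function of the parameters rather than of the points in space, so that it makes sense for
   curves which are not known to be injective. *)

definition arc_dist :: "(real \<Rightarrow> real^3) \<Rightarrow> real \<Rightarrow> real \<Rightarrow> real" where
  "arc_dist \<gamma> x y =
     (INF k::int. integral {min x (y + 2 * pi * of_int k)..max x (y + 2 * pi * of_int k)}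
                    (\<lambda>t. norm (deriv1 \<gamma> t)))"

(* The supremum runs over distinct parameters on the circle.  For a curve of constant positive
   speed their arc-length distance is positive, so by division in ennreal the quotient is
   infinite at a self-intersection. *)

definition distortion :: "(real \<Rightarrow> real^3) \<Rightarrow> ennreal" where
  "distortion \<gamma> =
     (SUP (x, y) \<in> {(x, y). x \<in> circle_dom \<and> y \<in> circle_dom \<and> x \<noteq> y}.
        ennreal (arc_dist \<gamma> x y) / ennreal (dist (\<gamma> x) (\<gamma> y)))"

(* Local absolute continuity, in the form of the fundamental theorem of calculus for the
   Lebesgue integral. *)

definition loc_abs_cont :: "(real \<Rightarrow> real^3) \<Rightarrow> bool" where
  "loc_abs_cont f \<longleftrightarrow>
     (AE x in lebesgue. f differentiable (at x)) \<and>
     (\<forall>a b. a \<le> b \<longrightarrow> deriv1 f absolutely_integrable_on {a..b} \<and>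
                      (deriv1 f has_integral (f b - f a)) {a..b})"

(* Finite bending energy means that the curve is of Sobolev class W^{2,2}: it is differentiable
   with absolutely continuous derivative, and the second derivative, which then exists almost
   everywhere, is square integrable.  Square integrability of the pointwise second derivative
   alone would also admit polygons, for which it vanishes almost everywhere. *)

definition finite_bending_energy :: "(real \<Rightarrow> real^3) \<Rightarrow> bool" where
  "finite_bending_energy \<gamma> \<longleftrightarrow>
     (\<forall>x. \<gamma> differentiable (at x)) \<and>
     loc_abs_cont (deriv1 \<gamma>) \<and>
     (\<lambda>x. (norm (deriv2 \<gamma> x))\<^sup>2) integrable_on {-pi..pi}"

(* Curvature of a constant speed curve. *)

definition curvature :: "(real \<Rightarrow> real^3) \<Rightarrow> real \<Rightarrow> real" where
  "curvature \<gamma> x = 4 * pi\<^sup>2 * norm (deriv2 \<gamma> x) / (curve_len \<gamma>)\<^sup>2"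

definition kappa_bar2 :: "(real \<Rightarrow> real^3) \<Rightarrow> real" where
  "kappa_bar2 \<gamma> =
     (curve_len \<gamma> / (2 * pi)) powr (1/2) *
     (1 / (2 * pi) * integral {-pi..pi} (\<lambda>x. (curvature \<gamma> x)\<^sup>2 * norm (deriv1 \<gamma> x))) powr (1/2)"

definition proj_perp :: "real^3 \<Rightarrow> real^3 \<Rightarrow> real^3" where
  "proj_perp \<sigma> v = v - (v \<bullet> \<sigma>) *\<^sub>R \<sigma>"

definition crossings :: "(real \<Rightarrow> real^3) \<Rightarrow> real^3 \<Rightarrow> (real \<times> real) set" where
  "crossings \<gamma> \<sigma> =
     {(x, z). x \<in> circle_dom \<and> z \<in> circle_dom \<and> z \<noteq> 0 \<and>
              proj_perp \<sigma> (\<gamma> x) = proj_perp \<sigma> (\<gamma> (x + z))}"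

(* Surface measure on the unit sphere, as the measure occurring in the polar coordinate formula:
   a Borel subset A of the sphere has measure 3 times the volume of the cone
   {t * a | 0 < t <= 1, a in A}.  Note that sgn v = v / norm v. *)

definition punctured_ball :: "(real^3) set" where
  "punctured_ball = cball 0 1 - {0}"

definition sphere_measure :: "(real^3) measure" where
  "sphere_measure =
     scale_measure 3
       (distr (restrict_space lborel punctured_ball) (restrict_space borel (sphere 0 1)) sgn)"

lemma sgn_measurable_sphere:
  "sgn \<in> restrict_space lborel punctured_ball \<rightarrow>\<^sub>M restrict_space borel (sphere (0 :: real^3) 1)"
proof -
  have "continuous_on punctured_ball (sgn :: real^3 \<Rightarrow> real^3)"
    unfolding sgn_div_norm[abs_def]
    by (intro continuous_intros) (auto simp: punctured_ball_def)
  then have "sgn \<in> borel_measurable (restrict_space borel punctured_ball :: (real^3) measure)"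
    by (rule borel_measurable_continuous_on_restrict)
  then have "sgn \<in> borel_measurable (restrict_space lborel punctured_ball :: (real^3) measure)"
    by (simp cong: measurable_cong_sets add: sets_restrict_space)
  then show ?thesis
    by (intro measurable_restrict_space2)
       (auto simp: space_restrict_space norm_sgn punctured_ball_def)
qed

lemma emeasure_sphere_measure:
  assumes "A \<in> sets borel" "A \<subseteq> sphere 0 1"
  shows "emeasure sphere_measure A = 3 * emeasure lborel {v \<in> punctured_ball. sgn v \<in> A}"
proof -
  have A: "A \<in> sets (restrict_space borel (sphere (0 :: real^3) 1))"
    using assms by (simp add: sets_restrict_space_iff)
  have ball: "punctured_ball \<in> sets lborel"
    by (simp add: punctured_ball_def)
  have "sgn -` A \<inter> space (restrict_space lborel punctured_ball) = {v \<in> punctured_ball. sgn v \<in> A}"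
    by (auto simp: space_restrict_space)
  then have "emeasure sphere_measure A =
      3 * emeasure (restrict_space lborel punctured_ball) {v \<in> punctured_ball. sgn v \<in> A}"
    using emeasure_distr[OF sgn_measurable_sphere A] by (simp add: sphere_measure_def)
  also have "emeasure (restrict_space lborel punctured_ball) {v \<in> punctured_ball. sgn v \<in> A} =
      emeasure lborel {v \<in> punctured_ball. sgn v \<in> A}"
    using ball by (intro emeasure_restrict_space) auto
  finally show ?thesis .
qed

lemma emeasure_sphere_measure_UNIV: "emeasure sphere_measure (sphere 0 1) = ennreal (4 * pi)"
proof -
  have "{v \<in> punctured_ball. sgn v \<in> sphere 0 1} = cball (0 :: real^3) 1 - {0}"
    by (auto simp: punctured_ball_def norm_sgn)
  then have "emeasure sphere_measure (sphere 0 1) = 3 * emeasure lborel (cball (0 :: real^3) 1 - {0})"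
    by (simp add: emeasure_sphere_measure)
  also have "emeasure lborel (cball (0 :: real^3) 1 - {0}) = emeasure lborel (cball (0 :: real^3) 1)"
    by (subst emeasure_Diff) auto
  also have "\<dots> = ennreal (4 / 3 * pi)"
    by (simp add: emeasure_cball unit_ball_vol_3)
  also have "3 * \<dots> = ennreal (4 * pi)"
    by (simp flip: ennreal_numeral ennreal_mult)
  finally show ?thesis .
qed

definition weighted_crossing_number :: "real \<Rightarrow> (real \<Rightarrow> real^3) \<Rightarrow> ennreal" where
  "weighted_crossing_number p \<gamma> =
     ennreal (1 / (4 * pi)) *
     (\<integral>\<^sup>+ \<sigma>. (\<Sum>\<^sub>\<infinity>(x, z)\<in>crossings \<gamma> \<sigma>.
                ennreal ((curve_len \<gamma> / arc_dist \<gamma> x (x + z)) powr p)) \<partial>sphere_measure)"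

end

theory Submission
  imports Defs
begin

text \<open>
A crossing with parameters \<open>(x, z)\<close> is seen along \<open>\<sigma>\<close> exactly if the chord
\<open>\<Delta> = \<gamma> (x + z) - \<gamma> x\<close> is parallel to \<open>\<sigma>\<close>. Up to a constant, the average over \<open>\<sigma>\<close> of the number
of crossings is therefore at most the integral of the Jacobian of the direction of the chord,
\<open>\<bar>det (\<Delta>, \<gamma>' x, \<gamma>' (x + z))\<bar> / \<bar>\<Delta>\<bar>\<^sup>3\<close>. In the determinant, \<open>\<gamma>' (x + z)\<close> may be replaced by
\<open>\<gamma>' (x + z) - \<gamma>' x\<close> and \<open>\<Delta>\<close> by \<open>\<Delta> - z \<gamma>' x\<close>. By the Cauchy-Schwarz inequality the first is
at most the square root of \<open>\<bar>z\<bar>\<close> times the integral of \<open>\<bar>\<gamma>''\<bar>\<^sup>2\<close> between the two parameters, and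
the second at most \<open>\<bar>z\<bar>\<close> times the same root (\<open>chord_jacobian_bound\<close>). For speed \<open>v\<close> the
distortion \<open>\<delta>\<close> gives \<open>\<bar>\<Delta>\<bar> \<ge> v \<bar>z\<bar> / \<delta>\<close>, so the Jacobian is at most
\<open>\<delta>\<^sup>3 / (v\<^sup>2 \<bar>z\<bar>)\<close> times that integral. Integration over \<open>x\<close> produces a further factor
\<open>\<bar>z\<bar>\<close> and the bending energy; the weight is at most \<open>(2 pi / \<bar>z\<bar>) powr p\<close>, and this is integrable
over \<open>z\<close> because \<open>p < 1\<close>.

The estimate is carried out on dyadic annuli \<open>h / 2 \<le> \<bar>z\<bar> \<le> h\<close>, on which the bounds for the
weight and for the chord are constant up to a factor, and by subdivision into small squares instead of an area formula
with multiplicities. The directions of the crossings in one square form a compact set, whose measure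
is bounded by the volume of an image of a box in three-space (\<open>emeasure_shadow_rectangle\<close>). The sum
over the squares telescopes (\<open>nn_integral_grid_count\<close>) to a bound independent of the mesh. The
number of crossings is at most the lower limit of the number of squares hit when the mesh tends to zero
(\<open>card_crossings_le_liminf\<close>), so Fatou's lemma bounds its integral, and no measurability of the number
of crossings itself has to be established. Summing over the annuli gives a geometric series
(\<open>nn_integral_crossings_le\<close>).
\<close>

section \<open>Determinants and volumes in three-space\<close>

text \<open>
The linear map is the derivative of \<open>(t, x, z) \<mapsto> t (\<gamma> (x + z) - \<gamma> x)\<close>, with \<open>D\<close> the chord and \<open>P\<close>, \<open>Q\<close>
the tangents at its ends. Multiples of \<open>P\<close> may be subtracted from \<open>D\<close> and from \<open>Q\<close>
without changing the determinant; the choice of \<open>z\<close> as the parameter difference makes both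
\<open>D - z P\<close> and \<open>Q - P\<close> small when the curve bends little.
\<close>

lemma det_cone_jacobian:
  fixes D P Q :: "real^3"
  shows "det (matrix (\<lambda>u. u $ 1 *\<^sub>R D + t *\<^sub>R ((u $ 2 + u $ 3) *\<^sub>R Q - u $ 2 *\<^sub>R P)))
    = t\<^sup>2 * ((D - z *\<^sub>R P) \<bullet> cross3 (Q - P) P)"
  by (simp add: matrix_def det_3 axis_def cross3_def inner_vec_def sum_3 vector_def
      power2_eq_square algebra_simps)

lemma norm_cross_le: "norm (cross3 x y) \<le> norm x * norm y" for x y :: "real^3"
proof -
  have "(norm (cross3 x y))\<^sup>2 \<le> (norm x * norm y)\<^sup>2"
    using norm_cross_dot[of x y] zero_le_power2[of "x \<bullet> y"] by linarith
  then show ?thesis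
    by (rule power2_le_imp_le) simp
qed

lemma content_box_3:
  fixes l u :: "real^3"
  assumes "l $ 1 \<le> u $ 1" "l $ 2 \<le> u $ 2" "l $ 3 \<le> u $ 3"
  shows "measure lebesgue (cbox l u) = (u $ 1 - l $ 1) * (u $ 2 - l $ 2) * (u $ 3 - l $ 3)"
proof -
  have "cbox l u \<noteq> {}"
    using assms by (simp add: interval_ne_empty_cart forall_3)
  then have "measure lebesgue (cbox l u) = (\<Prod>i\<in>UNIV. u $ i - l $ i)"
    by (simp add: content_cbox_cart measure_completion)
  then show ?thesis
    unfolding UNIV_3 by (simp add: mult.assoc)
qed

section \<open>Integrals of squares and of periodic functions\<close>

text \<open>
Integrating \<open>2 l \<bar>f\<bar> \<le> l\<^sup>2 + \<bar>f\<bar>\<^sup>2\<close> and taking for \<open>l\<close> the mean value of \<open>\<bar>f\<bar>\<close>, the optimal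
constant, gives the inequality.
\<close>

lemma norm_integral_cauchy_schwarz:
  fixes f :: "real \<Rightarrow> real^3"
  assumes f: "f absolutely_integrable_on {x..y}" and xy: "x < y"
    and f2: "(\<lambda>t. (norm (f t))\<^sup>2) integrable_on {x..y}"
  shows "(norm (integral {x..y} f))\<^sup>2 \<le> (y - x) * integral {x..y} (\<lambda>t. (norm (f t))\<^sup>2)"
proof -
  define A where "A = integral {x..y} (\<lambda>t. norm (f t))"
  define l where "l = A / (y - x)"
  have nf: "(\<lambda>t. norm (f t)) integrable_on {x..y}"
    using f by (simp add: absolutely_integrable_on_def)
  have A: "norm (integral {x..y} f) \<le> A"
    unfolding A_def using f
    by (intro integral_norm_bound_integral) (auto simp: absolutely_integrable_on_def)
  have "integral {x..y} (\<lambda>t. 2 * l * norm (f t)) \<le> integral {x..y} (\<lambda>t. l\<^sup>2 + (norm (f t))\<^sup>2)"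
  proof (rule integral_le)
    show "(\<lambda>t. 2 * l * norm (f t)) integrable_on {x..y}"
      using integrable_on_cmult_left[OF nf, of "2 * l"] by simp
    show "(\<lambda>t. l\<^sup>2 + (norm (f t))\<^sup>2) integrable_on {x..y}"
      by (intro integrable_add f2) auto
    show "2 * l * norm (f t) \<le> l\<^sup>2 + (norm (f t))\<^sup>2" for t
      using sum_squares_bound[of l "norm (f t)"] by simp
  qed
  then have "2 * l * A \<le> l\<^sup>2 * (y - x) + integral {x..y} (\<lambda>t. (norm (f t))\<^sup>2)"
    using xy by (simp add: integral_add f2 integrable_const_ivl A_def mult.commute)
  moreover have "l\<^sup>2 * (y - x) = l * A"
    using xy by (simp add: l_def power2_eq_square)
  ultimately have "l * A \<le> integral {x..y} (\<lambda>t. (norm (f t))\<^sup>2)"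
    by linarith
  then have "A\<^sup>2 \<le> (y - x) * integral {x..y} (\<lambda>t. (norm (f t))\<^sup>2)"
    using xy by (simp add: l_def divide_simps power2_eq_square mult.commute)
  moreover have "(norm (integral {x..y} f))\<^sup>2 \<le> A\<^sup>2"
    using A by (simp add: power_mono)
  ultimately show ?thesis by linarith
qed

lemma periodic_shift_integral:
  fixes f :: "real \<Rightarrow> real"
  assumes per: "\<And>x. f (x + T) = f x" and f: "(f has_integral i) {a..b}"
  shows "(f has_integral i) {a + T..b + T}" "(f has_integral i) {a - T..b - T}"
proof -
  have per': "f (x - T) = f x" for x
    using per[of "x - T"] by simp
  show "(f has_integral i) {a + T..b + T}"
    using has_integral_affinity'[of f i a b 1 "- T"] f per' by simp
  show "(f has_integral i) {a - T..b - T}"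
    using has_integral_affinity'[of f i a b 1 T] f per by simp
qed

lemma periodic_integrable_on:
  fixes f :: "real \<Rightarrow> real"
  assumes per: "\<And>x. f (x + T) = f x" and T: "0 < T" and f: "f integrable_on {a..a + T}"
  shows "f integrable_on {x..y}"
proof -
  have big: "f integrable_on {a - real n * T..a + T + real n * T}" for n
  proof (induction n)
    case 0
    show ?case using f by simp
  next
    case (Suc n)
    have nT: "0 \<le> real n * T" using T by simp
    let ?l = "a - real n * T" and ?u = "a + T + real n * T"
    have s: "f integrable_on {?l - T..?u - T}" "f integrable_on {?l + T..?u + T}"
      using periodic_shift_integral[of f T "integral {?l..?u} f" ?l ?u] Suc per
      by (auto simp: integrable_on_def)
    have l: "f integrable_on {?l - T..?l}"
      by (rule integrable_on_subinterval[OF s(1)]) (use T nT in auto)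
    have u: "f integrable_on {?u..?u + T}"
      by (rule integrable_on_subinterval[OF s(2)]) (use T nT in auto)
    have "f integrable_on {?l - T..?u}"
      using T nT by (intro Henstock_Kurzweil_Integration.integrable_combine[OF _ _ l Suc]) auto
    then have "f integrable_on {?l - T..?u + T}"
      using T nT by (intro Henstock_Kurzweil_Integration.integrable_combine[OF _ _ _ u]) auto
    then show ?case by (simp add: algebra_simps)
  qed
  obtain n :: nat where n: "(\<bar>x\<bar> + \<bar>y\<bar> + \<bar>a\<bar>) / T < real n"
    using reals_Archimedean2 by blast
  then have "\<bar>x\<bar> + \<bar>y\<bar> + \<bar>a\<bar> < real n * T"
    using T by (simp add: divide_simps)
  then show ?thesis
    using T by (intro integrable_on_subinterval[OF big[of n]]) auto
qed

text \<open>
The primitive replaces the integral of the squared second derivative over parameter intervals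
that leave the fundamental domain.
\<close>

lemma periodic_primitive_exists:
  fixes f :: "real \<Rightarrow> real"
  assumes per: "\<And>x. f (x + T) = f x" and T: "0 < T" and f: "f integrable_on {a..a + T}"
  obtains F where "\<And>x y. x \<le> y \<Longrightarrow> F y - F x = integral {x..y} f"
    "\<And>x. F (x + T) = F x + integral {a..a + T} f"
proof
  define F where "F x = integral {0..x} f - integral {x..0} f" for x
  have int: "f integrable_on {x..y}" for x y
    using periodic_integrable_on[OF per T f] .
  show diff: "F y - F x = integral {x..y} f" if "x \<le> y" for x y
  proof -
    note c = Henstock_Kurzweil_Integration.integral_combine[OF _ _ int, of _ _ _]
    consider "0 \<le> x" | "x \<le> 0" "0 \<le> y" | "y \<le> 0" by linarith
    then show ?thesis
    proof cases
      case 1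
      then show ?thesis
        using c[of 0 x y] that by (cases "x = 0"; cases "y = 0") (auto simp: F_def)
    next
      case 2
      then show ?thesis
        using c[of x 0 y] that by (cases "x = 0"; cases "y = 0") (auto simp: F_def)
    next
      case 3
      then show ?thesis
        using c[of x y 0] that by (cases "x = 0"; cases "y = 0") (auto simp: F_def)
    qed
  qed
  have step: "F (y + T) - F (x + T) = F y - F x" if "x \<le> y" for x y
  proof -
    have "integral {x + T..y + T} f = integral {x..y} f"
      using periodic_shift_integral(1)[of f T, OF per integrable_integral[OF int[of x y]]]
      by (rule integral_unique)
    then show ?thesis using diff[of x y] diff[of "x + T" "y + T"] that by simp
  qed
  show "F (x + T) = F x + integral {a..a + T} f" for x
    using step[of x a] step[of a x] diff[of a "a + T"] T by (cases "x \<le> a") auto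
qed

text \<open>
Overlapping windows of \<open>c\<close> steps, started at every point of one period, cover each step
\<open>c\<close> times. This discrete identity stands in for the Fubini argument that exchanges the
integrals over the position and over the offset within a window.
\<close>

lemma sum_increments_quasiperiodic:
  fixes G :: "nat \<Rightarrow> real"
  assumes "\<And>i. G (i + N) = G i + E"
  shows "(\<Sum>i<N. G (i + c) - G i) = real c * E"
proof (induction c)
  case (Suc c)
  have "(\<Sum>i<N. G (i + Suc c) - G i) =
      (\<Sum>i<N. G (i + c) - G i) + (\<Sum>i<N. G (Suc i + c) - G (i + c))"
    by (simp flip: sum.distrib)
  also have "(\<Sum>i<N. G (Suc i + c) - G (i + c)) = G (N + c) - G c"
    using sum_lessThan_telescope[of "\<lambda>i. G (i + c)" N] by simp
  also have "\<dots> = E"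
    using assms[of c] by (simp add: add.commute)
  finally show ?case using Suc by (simp add: algebra_simps)
qed simp

section \<open>Directions of crossings\<close>

definition shadow :: "(real \<Rightarrow> real^3) \<Rightarrow> (real \<times> real) set \<Rightarrow> (real^3) set" where
  "shadow \<gamma> Q = {\<sigma> \<in> sphere 0 1. \<exists>(x, z)\<in>Q. proj_perp \<sigma> (\<gamma> x) = proj_perp \<sigma> (\<gamma> (x + z))}"

text \<open>
A shadow is the projection of a compact set along the compact factor \<open>Q\<close>. This is why closed
parameter rectangles are used below: it makes the shadows Borel sets.
\<close>

lemma compact_shadow:
  assumes "continuous_on UNIV \<gamma>" "compact Q"
  shows "compact (shadow \<gamma> Q)"
proof -
  define Z where "Z = {w :: (real^3) \<times> real \<times> real.
     proj_perp (fst w) (\<gamma> (fst (snd w))) = proj_perp (fst w) (\<gamma> (fst (snd w) + snd (snd w)))}"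
  have "closed Z"
    unfolding Z_def proj_perp_def
    by (intro closed_Collect_eq continuous_intros continuous_on_compose2[OF assms(1)]) auto
  then have "compact ((sphere 0 1 \<times> Q) \<inter> Z)"
    using assms(2) by (intro compact_Int_closed compact_Times) auto
  then have "compact (fst ` ((sphere 0 1 \<times> Q) \<inter> Z))"
    by (intro compact_continuous_image continuous_intros)
  moreover have "fst ` ((sphere 0 1 \<times> Q) \<inter> Z) = shadow \<gamma> Q"
    by (force simp: shadow_def Z_def image_iff)
  ultimately show ?thesis by simp
qed

lemma proj_perp_eqD:
  assumes "proj_perp \<sigma> a = proj_perp \<sigma> b" "norm \<sigma> = 1"
  obtains c where "b - a = c *\<^sub>R \<sigma>" "\<bar>c\<bar> = norm (b - a)"
proof
  show eq: "b - a = (b \<bullet> \<sigma> - a \<bullet> \<sigma>) *\<^sub>R \<sigma>"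
    using assms(1) by (simp add: proj_perp_def algebra_simps)
  show "\<bar>b \<bullet> \<sigma> - a \<bullet> \<sigma>\<bar> = norm (b - a)"
    by (subst eq) (simp add: assms(2))
qed

section \<open>Volume of the cone over the directions of crossings\<close>

text \<open>
The estimates only use a few consequences of the hypotheses on the curve. The function \<open>\<Psi>\<close> is
a primitive of \<open>\<bar>\<gamma>''\<bar>\<^sup>2\<close>, so that \<open>energy\<close> is the Cauchy-Schwarz inequality, and \<open>E\<close> is
the integral of \<open>\<bar>\<gamma>''\<bar>\<^sup>2\<close> over one period; \<open>d\<close> is the distortion.
\<close>

locale energy_curve =
  fixes \<gamma> \<gamma>' :: "real \<Rightarrow> real^3" and \<Psi> :: "real \<Rightarrow> real" and v d E :: real
  assumes deriv: "\<And>x. (\<gamma> has_vector_derivative \<gamma>' x) (at x)"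
    and speed: "\<And>x. norm (\<gamma>' x) = v"
    and v_pos: "0 < v"
    and energy_mono: "\<And>x y. x \<le> y \<Longrightarrow> \<Psi> x \<le> \<Psi> y"
    and energy: "\<And>x y. x \<le> y \<Longrightarrow> (norm (\<gamma>' y - \<gamma>' x))\<^sup>2 \<le> (y - x) * (\<Psi> y - \<Psi> x)"
    and energy_period: "\<And>x. \<Psi> (x + 2 * pi) = \<Psi> x + E"
    and d_pos: "0 < d"
    and chord: "\<And>x z. z \<noteq> 0 \<Longrightarrow> \<bar>z\<bar> \<le> pi \<Longrightarrow> v * \<bar>z\<bar> \<le> d * norm (\<gamma> (x + z) - \<gamma> x)"
begin

lemma tangent_change:
  assumes "l \<le> x" "x \<le> u" "l \<le> y" "y \<le> u" "\<bar>y - x\<bar> \<le> h"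
  shows "norm (\<gamma>' y - \<gamma>' x) \<le> sqrt (h * (\<Psi> u - \<Psi> l))"
proof -
  have *: "(norm (\<gamma>' b - \<gamma>' a))\<^sup>2 \<le> h * (\<Psi> u - \<Psi> l)"
    if "l \<le> a" "a \<le> b" "b \<le> u" "b - a \<le> h" for a b
  proof -
    have "(norm (\<gamma>' b - \<gamma>' a))\<^sup>2 \<le> (b - a) * (\<Psi> b - \<Psi> a)"
      using energy that by blast
    also have "\<dots> \<le> h * (\<Psi> u - \<Psi> l)"
      using that energy_mono[of l a] energy_mono[of b u] energy_mono[of a b]
      by (intro mult_mono) auto
    finally show ?thesis .
  qed
  show ?thesis
    using *[of x y] *[of y x] assms
    by (cases "x \<le> y") (auto intro!: real_le_rsqrt simp: norm_minus_commute)
qed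

lemma continuous_curve: "continuous_on S \<gamma>"
  using deriv by (meson continuous_at_imp_continuous_on has_vector_derivative_continuous)

lemma continuous_tangent: "continuous_on S \<gamma>'"
proof (rule continuous_at_imp_continuous_on, rule ballI)
  fix x
  have "(\<lambda>y. norm (\<gamma>' y - \<gamma>' x)) \<midarrow>x\<rightarrow> 0"
  proof (rule tendsto_sandwich)
    show "\<forall>\<^sub>F y in at x. 0 \<le> norm (\<gamma>' y - \<gamma>' x)" by simp
    have "((\<lambda>y. sqrt (\<bar>y - x\<bar> * (\<Psi> (x + 1) - \<Psi> (x - 1)))) \<longlongrightarrow> sqrt (\<bar>x - x\<bar> * (\<Psi> (x + 1) - \<Psi> (x - 1)))) (at x)"
      by (intro tendsto_intros)
    then show "(\<lambda>y. sqrt (\<bar>y - x\<bar> * (\<Psi> (x + 1) - \<Psi> (x - 1)))) \<midarrow>x\<rightarrow> 0" by simp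
    have "\<forall>\<^sub>F y in at x. dist y x < 1"
      by (auto simp: eventually_at intro!: exI[of _ 1])
    then show "\<forall>\<^sub>F y in at x. norm (\<gamma>' y - \<gamma>' x) \<le> sqrt (\<bar>y - x\<bar> * (\<Psi> (x + 1) - \<Psi> (x - 1)))"
      by (rule eventually_mono) (rule tangent_change, auto simp: dist_real_def)
  qed simp
  then show "isCont \<gamma>' x"
    by (simp add: isCont_def tendsto_norm_zero_iff LIM_zero_iff)
qed

text \<open>
The quadratic gain that makes the crossing density integrable: both the change of the tangent
and the deviation of the chord from the tangent line, divided by \<open>h\<close>, are at most
\<open>sqrt (h (\<Psi> u - \<Psi> l))\<close>.
\<close>

lemma chord_jacobian_bound:
  assumes "\<bar>z\<bar> \<le> h" "l \<le> x - h" "x + h \<le> u"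
  shows "\<bar>(\<gamma> (x + z) - \<gamma> x - z *\<^sub>R \<gamma>' x) \<bullet> cross3 (\<gamma>' (x + z) - \<gamma>' x) (\<gamma>' x)\<bar>
     \<le> v * h\<^sup>2 * (\<Psi> u - \<Psi> l)"
proof -
  define B where "B = sqrt (h * (\<Psi> u - \<Psi> l))"
  have h: "0 \<le> h" using assms by linarith
  have B: "norm (\<gamma>' y - \<gamma>' x) \<le> B" if "y \<in> closed_segment x (x + z)" for y
    unfolding B_def using that assms
    by (intro tangent_change) (auto simp: closed_segment_eq_real_ivl split: if_splits)
  have "0 \<le> \<Psi> u - \<Psi> l"
    using energy_mono[of l u] assms h by simp
  then have B2: "B * B = h * (\<Psi> u - \<Psi> l)" "0 \<le> B"
    using h by (auto simp: B_def)
  have "norm (\<gamma> (x + z) - \<gamma> x - (x + z - x) *\<^sub>R \<gamma>' x) \<le> norm (x + z - x) * B"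
    by (rule vector_differentiable_bound_linearization[of "closed_segment x (x + z)"])
       (use B in \<open>auto intro: has_vector_derivative_at_within[OF deriv]\<close>)
  also have "\<dots> \<le> h * B"
    using assms B2 by (intro mult_right_mono) auto
  finally have 1: "norm (\<gamma> (x + z) - \<gamma> x - z *\<^sub>R \<gamma>' x) \<le> h * B" by simp
  have "norm (cross3 (\<gamma>' (x + z) - \<gamma>' x) (\<gamma>' x)) \<le> norm (\<gamma>' (x + z) - \<gamma>' x) * norm (\<gamma>' x)"
    by (rule norm_cross_le)
  also have "\<dots> \<le> B * v"
    using B[of "x + z"] B2 speed v_pos by (intro mult_mono) auto
  finally have 2: "norm (cross3 (\<gamma>' (x + z) - \<gamma>' x) (\<gamma>' x)) \<le> B * v" .
  have "\<bar>(\<gamma> (x + z) - \<gamma> x - z *\<^sub>R \<gamma>' x) \<bullet> cross3 (\<gamma>' (x + z) - \<gamma>' x) (\<gamma>' x)\<bar> \<le> (h * B) * (B * v)"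
    by (rule order_trans[OF Cauchy_Schwarz_ineq2 mult_mono[OF 1 2]]) (use h B2 in auto)
  also have "\<dots> = v * h * (B * B)"
    by simp
  also have "\<dots> = v * h\<^sup>2 * (\<Psi> u - \<Psi> l)"
    unfolding B2 by (simp add: power2_eq_square)
  finally show ?thesis .
qed

text \<open>
The unnormalised chord is used instead of its direction. The price is a longer range for the
factor \<open>w $ 1\<close>; the gain is that no norm has to be differentiated.
\<close>

definition cone_map :: "real^3 \<Rightarrow> real^3" where
  "cone_map w = w $ 1 *\<^sub>R (\<gamma> (w $ 2 + w $ 3) - \<gamma> (w $ 2))"

definition cone_deriv :: "real^3 \<Rightarrow> real^3 \<Rightarrow> real^3" where
  "cone_deriv w u = u $ 1 *\<^sub>R (\<gamma> (w $ 2 + w $ 3) - \<gamma> (w $ 2)) +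
     w $ 1 *\<^sub>R ((u $ 2 + u $ 3) *\<^sub>R \<gamma>' (w $ 2 + w $ 3) - u $ 2 *\<^sub>R \<gamma>' (w $ 2))"

lemma cone_map_has_derivative: "(cone_map has_derivative cone_deriv w) (at w within S)"
proof -
  have g: "(\<gamma> has_derivative (\<lambda>u. u *\<^sub>R \<gamma>' x)) (at x)" for x
    using deriv[of x] by (simp add: has_vector_derivative_def)
  have c: "((\<lambda>w. w $ i) has_derivative (\<lambda>u. u $ i)) (at w within S)" for i :: 3 and w :: "real^3"
    by (rule bounded_linear_imp_has_derivative[OF bounded_linear_vec_nth])
  have "((\<lambda>w. \<gamma> (w $ 2)) has_derivative (\<lambda>u. (u $ 2) *\<^sub>R \<gamma>' (w $ 2))) (at w within S)"
    using has_derivative_compose[OF c g] .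
  moreover have "((\<lambda>w. \<gamma> (w $ 2 + w $ 3)) has_derivative
      (\<lambda>u. (u $ 2 + u $ 3) *\<^sub>R \<gamma>' (w $ 2 + w $ 3))) (at w within S)"
    using has_derivative_compose[OF has_derivative_add[OF c c] g] .
  ultimately show ?thesis
    unfolding cone_map_def cone_deriv_def
    by (auto intro!: derivative_eq_intros c simp: algebra_simps)
qed

lemma det_cone_deriv:
  "det (matrix (cone_deriv w)) = (w $ 1)\<^sup>2 *
     ((\<gamma> (w $ 2 + w $ 3) - \<gamma> (w $ 2) - w $ 3 *\<^sub>R \<gamma>' (w $ 2)) \<bullet>
      cross3 (\<gamma>' (w $ 2 + w $ 3) - \<gamma>' (w $ 2)) (\<gamma>' (w $ 2)))"
  unfolding cone_deriv_def by (rule det_cone_jacobian)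

text \<open>
If \<open>\<sigma>\<close> sees a crossing at \<open>(x, z)\<close>, the chord is a multiple of \<open>\<sigma>\<close> of length at least \<open>m\<close>, so
every point of the ray through \<open>\<sigma>\<close> in the unit ball is a multiple of the chord with a factor at
most \<open>1 / m\<close>. Negative factors account for chords pointing in the direction \<open>- \<sigma>\<close>.
\<close>

lemma shadow_cone_subset:
  assumes m: "0 < m" "\<And>x z. (x, z) \<in> Q \<Longrightarrow> m \<le> norm (\<gamma> (x + z) - \<gamma> x)"
  shows "{p \<in> punctured_ball. sgn p \<in> shadow \<gamma> Q} \<subseteq>
    cone_map ` {w. \<bar>w $ 1\<bar> \<le> 1 / m \<and> (w $ 2, w $ 3) \<in> Q}"
proof safe
  fix p assume p: "p \<in> punctured_ball" "sgn p \<in> shadow \<gamma> Q"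
  then obtain x z where xz: "(x, z) \<in> Q" "proj_perp (sgn p) (\<gamma> x) = proj_perp (sgn p) (\<gamma> (x + z))"
    by (auto simp: shadow_def)
  have p0: "p \<noteq> 0" and p1: "norm p \<le> 1"
    using p(1) by (auto simp: punctured_ball_def)
  obtain c where c: "\<gamma> (x + z) - \<gamma> x = c *\<^sub>R sgn p" "\<bar>c\<bar> = norm (\<gamma> (x + z) - \<gamma> x)"
    using proj_perp_eqD[OF xz(2)] p0 by (auto simp: norm_sgn)
  have cm: "m \<le> \<bar>c\<bar>" using m(2)[OF xz(1)] c(2) by simp
  define t where "t = norm p / c"
  have "p = t *\<^sub>R (\<gamma> (x + z) - \<gamma> x)"
    using cm m(1) p0 by (simp add: c(1) t_def sgn_div_norm)
  moreover have "\<bar>t\<bar> \<le> 1 / m"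
    unfolding t_def abs_divide using p1 cm m(1) by (intro frac_le) auto
  ultimately show "p \<in> cone_map ` {w. \<bar>w $ 1\<bar> \<le> 1 / m \<and> (w $ 2, w $ 3) \<in> Q}"
    using xz(1) by (intro image_eqI[of _ _ "vector [t, x, z]"]) (auto simp: cone_map_def)
qed

text \<open>
The measure of a set of directions is three times the volume of the cone over it. That cone is
contained in the image under \<open>cone_map\<close> of a box of volume \<open>2 s\<^sup>2 / m\<close>, where \<open>m\<close> is the
lower bound \<open>v h / (2 d)\<close> which the distortion puts on the chord, and on the box the Jacobian is
at most \<open>v h\<^sup>2 (\<Psi> (a + s + h) - \<Psi> (a - h)) / m\<^sup>2\<close>.
\<close>

lemma emeasure_shadow_rectangle:
  assumes h: "0 < h" "h \<le> pi" and s: "0 < s"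
    and z: "\<And>z. z \<in> {b..b + s} \<Longrightarrow> h / 2 \<le> \<bar>z\<bar> \<and> \<bar>z\<bar> \<le> h"
  shows "emeasure sphere_measure (shadow \<gamma> ({a..a + s} \<times> {b..b + s}))
    \<le> ennreal (48 * d^3 / (v\<^sup>2 * h) * s\<^sup>2 * (\<Psi> (a + s + h) - \<Psi> (a - h)))"
proof -
  let ?Q = "{a..a + s} \<times> {b..b + s}"
  define m where "m = v * h / (2 * d)"
  define B where "B = (1 / m)\<^sup>2 * (v * h\<^sup>2 * (\<Psi> (a + s + h) - \<Psi> (a - h)))"
  define S :: "(real^3) set" where "S = cbox (vector [- (1 / m), a, b]) (vector [1 / m, a + s, b + s])"
  have m: "0 < m"
    using v_pos d_pos h by (simp add: m_def)
  have S_eq: "S = {w. \<bar>w $ 1\<bar> \<le> 1 / m \<and> (w $ 2, w $ 3) \<in> ?Q}"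
    by (auto simp: S_def mem_box_cart forall_3)
  have mS: "measure lebesgue S = 2 / m * s\<^sup>2"
    unfolding S_def using m s by (subst content_box_3) (auto simp: power2_eq_square)
  have far: "m \<le> norm (\<gamma> (x + z) - \<gamma> x)" if "(x, z) \<in> ?Q" for x z
  proof -
    have "h / 2 \<le> \<bar>z\<bar>" "\<bar>z\<bar> \<le> h" using z that by auto
    then have "v * (h / 2) \<le> d * norm (\<gamma> (x + z) - \<gamma> x)"
      using chord[of z x] h v_pos by (intro order_trans[OF mult_left_mono chord]) auto
    then show ?thesis using d_pos by (simp add: m_def divide_simps mult.commute)
  qed
  have bound: "\<bar>det (matrix (cone_deriv w))\<bar> \<le> B" if "w \<in> S" for w
  proof -
    have w: "\<bar>w $ 1\<bar> \<le> 1 / m" "w $ 2 \<in> {a..a + s}" "w $ 3 \<in> {b..b + s}"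
      using that by (auto simp: S_eq)
    have "(w $ 1)\<^sup>2 \<le> (1 / m)\<^sup>2"
      using power_mono[OF w(1), of 2] by simp
    then show ?thesis
      unfolding det_cone_deriv B_def abs_mult
      using w(2) z[OF w(3)]
      by (intro mult_mono chord_jacobian_bound) auto
  qed
  have int: "(\<lambda>w. \<bar>det (matrix (cone_deriv w))\<bar>) integrable_on S"
    unfolding det_cone_deriv S_def cross3_def inner_vec_def sum_3 vector_3
    by (intro integrable_continuous continuous_intros continuous_on_compose2[OF continuous_curve]
        continuous_on_compose2[OF continuous_tangent] continuous_on_component) auto
  have meas: "S \<in> lmeasurable" by (simp add: S_def)
  have fm: "cone_map ` S \<in> lmeasurable"
    using measurable_bounded_differentiable_image[OF meas cone_map_has_derivative int bound] .
  have "measure lebesgue (cone_map ` S) \<le> B * measure lebesgue S"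
    using measure_bounded_differentiable_image[OF meas cone_map_has_derivative int bound] .
  then have vol: "emeasure lebesgue (cone_map ` S) \<le> ennreal (B * (2 / m * s\<^sup>2))"
    using fm by (simp add: mS emeasure_eq_measure2 ennreal_leI)
  have cl: "compact (shadow \<gamma> ?Q)"
    by (intro compact_shadow continuous_curve compact_Times) auto
  let ?K = "{p \<in> punctured_ball. sgn p \<in> shadow \<gamma> ?Q}"
  have K: "?K \<in> sets borel"
  proof -
    have "sgn \<in> borel_measurable (borel :: (real^3) measure)"
      unfolding sgn_div_norm[abs_def] by measurable
    then have "{p :: real^3. sgn p \<in> shadow \<gamma> ?Q} \<in> sets borel"
      using borel_compact[OF cl] measurable_sets[of sgn borel borel "shadow \<gamma> ?Q"]
      by (simp add: vimage_def)
    moreover have "punctured_ball \<in> sets borel" by (simp add: punctured_ball_def)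
    ultimately have "punctured_ball \<inter> {p. sgn p \<in> shadow \<gamma> ?Q} \<in> sets borel" by blast
    then show ?thesis by (simp add: Int_def)
  qed
  have "emeasure sphere_measure (shadow \<gamma> ?Q) = 3 * emeasure lborel ?K"
    by (rule emeasure_sphere_measure) (use borel_compact[OF cl] in \<open>auto simp: shadow_def\<close>)
  also have "emeasure lborel ?K = emeasure lebesgue ?K"
    using K by simp
  also have "\<dots> \<le> emeasure lebesgue (cone_map ` S)"
  proof (rule emeasure_mono)
    show "?K \<subseteq> cone_map ` S"
      unfolding S_eq by (rule shadow_cone_subset[OF m]) (rule far)
  qed (use fm in auto)
  also note vol
  also have "3 * ennreal (B * (2 / m * s\<^sup>2)) = ennreal (3 * (B * (2 / m * s\<^sup>2)))"
    by (subst ennreal_mult') auto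
  also have "3 * (B * (2 / m * s\<^sup>2)) =
      48 * d^3 / (v\<^sup>2 * h) * s\<^sup>2 * (\<Psi> (a + s + h) - \<Psi> (a - h))"
    using v_pos h d_pos by (simp add: B_def m_def field_simps power2_eq_square power3_eq_cube)
  finally show ?thesis
    by (simp add: mult_left_mono)
qed

end

section \<open>Counting crossings with grids\<close>

text \<open>
The half-open ends point the same way on both sides, as in \<open>circle_dom\<close>, so that the annuli
cover the offset \<open>- pi\<close> and fit the rounding by \<open>floor\<close> in \<open>cell_index\<close>.
\<close>

definition dyadic_annulus :: "nat \<Rightarrow> real set" where
  "dyadic_annulus k = {pi / 2 ^ k / 2..<pi / 2 ^ k} \<union> {- (pi / 2 ^ k)..<- (pi / 2 ^ k / 2)}"

lemma dyadic_annulus_exists: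
  assumes "z \<in> circle_dom" "z \<noteq> 0"
  shows "\<exists>k. z \<in> dyadic_annulus k"
proof -
  have small: "\<exists>n. pi / 2 ^ n < y" if "0 < y" for y :: real
  proof -
    obtain n where "pi / y < 2 ^ n"
      using real_arch_pow[of 2 "pi / y"] by auto
    then have "pi / 2 ^ n < y"
      using that by (simp add: divide_simps mult.commute)
    then show ?thesis ..
  qed
  \<comment> \<open>The annulus lies between two consecutive radii \<open>pi / 2 ^ n\<close> on different sides of \<open>\<bar>z\<bar>\<close>.\<close>
  have cross: "\<exists>k. \<not> P k \<and> P (Suc k)" if "P n" "\<not> P 0" for P and n :: nat
    using that by (induction n) auto
  have half: "pi / 2 ^ Suc k = pi / 2 ^ k / 2" for k by simp
  show ?thesis
  proof (cases "0 < z")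
    case True
    obtain n where "pi / 2 ^ n \<le> z" using small[OF True] by (auto intro: less_imp_le)
    moreover have "\<not> pi / 2 ^ 0 \<le> z" using assms by (simp add: circle_dom_def)
    ultimately obtain k where "\<not> pi / 2 ^ k \<le> z" "pi / 2 ^ Suc k \<le> z"
      using cross[of "\<lambda>n. pi / 2 ^ n \<le> z"] by blast
    then have "z \<in> dyadic_annulus k"
      unfolding half dyadic_annulus_def by auto
    then show ?thesis ..
  next
    case False
    obtain n where "pi / 2 ^ n < - z" using small[of "- z"] False assms(2) by auto
    moreover have "\<not> pi / 2 ^ 0 < - z" using assms by (simp add: circle_dom_def)
    ultimately obtain k where "\<not> pi / 2 ^ k < - z" "pi / 2 ^ Suc k < - z"
      using cross[of "\<lambda>n. pi / 2 ^ n < - z"] by blast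
    then have "z \<in> dyadic_annulus k"
      unfolding half dyadic_annulus_def by auto
    then show ?thesis ..
  qed
qed

text \<open>
For each \<open>k\<close> and \<open>r\<close> a grid of closed squares of side \<open>mesh k r\<close> covers the parameters
\<open>(x, z)\<close> with \<open>z\<close> in the annulus \<open>k\<close>. The side divides both the period and the radii of the annulus,
so that no square leaves the closed annulus and the sums over the grid telescope exactly.
\<close>

definition mesh :: "nat \<Rightarrow> nat \<Rightarrow> real" where
  "mesh k r = pi / 2 ^ k / (2 * real r)"

definition grid :: "nat \<Rightarrow> nat \<Rightarrow> (nat \<times> int) set" where
  "grid k r = {..<2 ^ Suc k * (2 * r)} \<times> ({int r..<2 * int r} \<union> {- 2 * int r..<- int r})"

definition cell :: "nat \<Rightarrow> nat \<Rightarrow> nat \<times> int \<Rightarrow> (real \<times> real) set" where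
  "cell k r ij = {- pi + real (fst ij) * mesh k r..- pi + real (fst ij) * mesh k r + mesh k r} \<times>
     {of_int (snd ij) * mesh k r..of_int (snd ij) * mesh k r + mesh k r}"

text \<open>
Crossings on common sides of squares are counted repeatedly, which is harmless for an upper bound.
\<close>

definition grid_count :: "(real \<Rightarrow> real^3) \<Rightarrow> nat \<Rightarrow> nat \<Rightarrow> real^3 \<Rightarrow> ennreal" where
  "grid_count \<gamma> k r \<sigma> = (\<Sum>ij\<in>grid k r. indicator (shadow \<gamma> (cell k r ij)) \<sigma>)"

lemma mesh_pos: "0 < r \<Longrightarrow> 0 < mesh k r"
  by (simp add: mesh_def)

lemma mesh_times: "0 < r \<Longrightarrow> 2 * real r * mesh k r = pi / 2 ^ k"
  by (simp add: mesh_def)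

lemma mesh_tendsto_0: "mesh k \<longlonglongrightarrow> 0"
proof -
  have "(\<lambda>r. pi / 2 ^ k / 2 * (1 / real r)) \<longlonglongrightarrow> pi / 2 ^ k / 2 * 0"
    by (intro tendsto_mult tendsto_const lim_1_over_n)
  then show ?thesis
    by (simp add: mesh_def[abs_def] mult.assoc)
qed

lemma grid_cell_distance:
  assumes ij: "(i, j) \<in> grid k r" and r: "0 < r"
    and z: "z \<in> {j * mesh k r..j * mesh k r + mesh k r}"
  shows "pi / 2 ^ k / 2 \<le> \<bar>z\<bar>" "\<bar>z\<bar> \<le> pi / 2 ^ k"
proof -
  let ?s = "mesh k r"
  have s: "0 < ?s" using mesh_pos[OF r] .
  have h: "pi / 2 ^ k = 2 * real r * ?s" using mesh_times[OF r] by simp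
  have "(real r \<le> j \<and> j + 1 \<le> 2 * real r) \<or> (- 2 * real r \<le> j \<and> j + 1 \<le> - real r)"
    using ij by (auto simp: grid_def)
  then have "(real r * ?s \<le> j * ?s \<and> (j + 1) * ?s \<le> (2 * real r) * ?s) \<or>
     ((- 2 * real r) * ?s \<le> j * ?s \<and> (j + 1) * ?s \<le> (- real r) * ?s)"
    using s by (metis mult_right_mono less_imp_le)
  then show "pi / 2 ^ k / 2 \<le> \<bar>z\<bar>" "\<bar>z\<bar> \<le> pi / 2 ^ k"
    using z unfolding h by (auto simp: algebra_simps)
qed

lemma floor_divide_cell:
  assumes "0 < s"
  shows "x \<in> {of_int \<lfloor>x / s\<rfloor> * s..of_int \<lfloor>x / s\<rfloor> * s + s}"
  using floor_divide_lower[OF assms, of x] floor_divide_upper[OF assms, of x]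
  by (simp add: algebra_simps)

lemma floor_divide_eq_imp_close:
  assumes "0 < s" "\<lfloor>x / s\<rfloor> = \<lfloor>y / s\<rfloor>"
  shows "\<bar>x - y\<bar> \<le> s"
  using floor_divide_cell[OF assms(1), of x] floor_divide_cell[OF assms(1), of y] assms(2) by auto

definition cell_index :: "nat \<Rightarrow> nat \<Rightarrow> real \<times> real \<Rightarrow> nat \<times> int" where
  "cell_index k r p = (nat \<lfloor>(fst p + pi) / mesh k r\<rfloor>, \<lfloor>snd p / mesh k r\<rfloor>)"

lemma cell_index:
  assumes r: "0 < r" and x: "x \<in> circle_dom" and z: "z \<in> dyadic_annulus k"
  shows "cell_index k r (x, z) \<in> grid k r" "(x, z) \<in> cell k r (cell_index k r (x, z))"
proof -
  let ?s = "mesh k r"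
  have s: "0 < ?s" using mesh_pos[OF r] .
  have h: "pi / 2 ^ k = 2 * real r * ?s" using mesh_times[OF r] by simp
  then have "2 * pi = real (2 ^ Suc k * (2 * r)) * ?s"
    by (simp add: field_simps)
  moreover have x': "0 \<le> x + pi" "x + pi < 2 * pi" using x by (auto simp: circle_dom_def)
  ultimately have "(x + pi) / ?s < real (2 ^ Suc k * (2 * r))"
    unfolding pos_divide_less_eq[OF s] by linarith
  then have "\<lfloor>(x + pi) / ?s\<rfloor> < int (2 ^ Suc k * (2 * r))"
    unfolding floor_less_iff by simp
  moreover have x0: "0 \<le> \<lfloor>(x + pi) / ?s\<rfloor>"
    using x' s by simp
  ultimately have i: "nat \<lfloor>(x + pi) / ?s\<rfloor> < 2 ^ Suc k * (2 * r)"
    by linarith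
  have "z \<in> {real r * ?s..<2 * real r * ?s} \<or> z \<in> {- 2 * real r * ?s..<- real r * ?s}"
    using z unfolding dyadic_annulus_def h by auto
  then have "z / ?s \<in> {real r..<2 * real r} \<or> z / ?s \<in> {- 2 * real r..<- real r}"
    using s by (simp add: pos_le_divide_eq pos_divide_less_eq)
  then have "\<lfloor>z / ?s\<rfloor> \<in> {int r..<2 * int r} \<union> {- 2 * int r..<- int r}"
    by (auto simp: le_floor_iff floor_less_iff)
  then show "cell_index k r (x, z) \<in> grid k r"
    using i by (simp add: cell_index_def grid_def)
  show "(x, z) \<in> cell k r (cell_index k r (x, z))"
    using floor_divide_cell[OF s, of "x + pi"] floor_divide_cell[OF s, of z] x0
    by (simp add: cell_index_def cell_def algebra_simps)
qed

lemma eventually_inj_cell_index: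
  assumes F: "finite F" "\<And>x z. (x, z) \<in> F \<Longrightarrow> x \<in> circle_dom"
  shows "\<forall>\<^sub>F r in sequentially. inj_on (cell_index k r) F"
proof -
  have sep: "\<forall>\<^sub>F r in sequentially. cell_index k r p \<noteq> cell_index k r q"
    if pq: "p \<in> F" "q \<in> F" "p \<noteq> q" for p q
  proof -
    obtain x z x' z' where p: "p = (x, z)" and q: "q = (x', z')" by fastforce
    define e where "e = max \<bar>x - x'\<bar> \<bar>z - z'\<bar>"
    have "0 < e" using pq by (auto simp: e_def p q less_max_iff_disj)
    then have "\<forall>\<^sub>F r in sequentially. mesh k r < e"
      by (rule order_tendstoD(2)[OF mesh_tendsto_0])
    then show ?thesis
      using eventually_gt_at_top[of 0]
    proof eventually_elim
      case (elim r)
      have s: "0 < mesh k r" using elim(2) by (rule mesh_pos)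
      have "0 \<le> \<lfloor>(x + pi) / mesh k r\<rfloor>" "0 \<le> \<lfloor>(x' + pi) / mesh k r\<rfloor>"
        using F(2)[of x z] F(2)[of x' z'] pq s by (auto simp: p q circle_dom_def)
      then show ?case
        using floor_divide_eq_imp_close[OF s, of "x + pi" "x' + pi"]
          floor_divide_eq_imp_close[OF s, of z z'] elim(1)
        by (auto simp: cell_index_def p q e_def eq_nat_nat_iff)
    qed
  qed
  have "\<forall>\<^sub>F r in sequentially. \<forall>p\<in>F. \<forall>q\<in>F. p \<noteq> q \<longrightarrow> cell_index k r p \<noteq> cell_index k r q"
    using F(1) sep by (intro eventually_ball_finite ballI) (auto simp: eventually_const_iff)
  then show ?thesis
    by (rule eventually_mono) (auto simp: inj_on_def)
qed

text \<open>
Finitely many crossings lie in distinct squares as soon as the mesh is smaller than their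
distances.
\<close>

lemma card_crossings_le_liminf:
  assumes \<sigma>: "\<sigma> \<in> sphere 0 1" and F: "finite F" "F \<subseteq> crossings \<gamma> \<sigma>"
    and ann: "\<And>x z. (x, z) \<in> F \<Longrightarrow> z \<in> dyadic_annulus k"
  shows "of_nat (card F) \<le> liminf (\<lambda>r. grid_count \<gamma> k r \<sigma>)"
proof (rule Liminf_bounded)
  have dom: "x \<in> circle_dom" if "(x, z) \<in> F" for x z
    using F(2) that by (auto simp: crossings_def)
  have inj: "\<forall>\<^sub>F r in sequentially. inj_on (cell_index k r) F"
    using F(1) dom by (rule eventually_inj_cell_index)
  show "\<forall>\<^sub>F r in sequentially. of_nat (card F) \<le> grid_count \<gamma> k r \<sigma>"
    using inj eventually_gt_at_top[of 0]
  proof eventually_elim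
    case (elim r)
    have fin: "finite (grid k r)" by (simp add: grid_def)
    have "(of_nat (card F) :: ennreal) = (\<Sum>ij\<in>cell_index k r ` F. 1)"
      using elim(1) by (simp add: card_image)
    also have "\<dots> \<le> (\<Sum>ij\<in>cell_index k r ` F. indicator (shadow \<gamma> (cell k r ij)) \<sigma>)"
    proof (rule sum_mono)
      fix ij assume "ij \<in> cell_index k r ` F"
      then obtain x z where xz: "(x, z) \<in> F" "ij = cell_index k r (x, z)" by auto
      have "\<sigma> \<in> shadow \<gamma> (cell k r ij)"
        using cell_index(2)[OF elim(2) dom[OF xz(1)] ann[OF xz(1)]] F(2) xz \<sigma>
        unfolding shadow_def crossings_def by blast
      then show "(1 :: ennreal) \<le> indicator (shadow \<gamma> (cell k r ij)) \<sigma>" by simp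
    qed
    also have "\<dots> \<le> grid_count \<gamma> k r \<sigma>"
      unfolding grid_count_def
      using cell_index(1)[OF elim(2) dom ann] by (intro sum_mono2 fin) auto
    finally show ?case .
  qed
qed

section \<open>Integration over the sphere\<close>

context energy_curve
begin

lemma energy_nonneg: "0 \<le> E"
  using energy_mono[of 0 "2 * pi"] energy_period[of 0] by simp

lemma shadow_in_sets: "shadow \<gamma> (cell k r ij) \<in> sets sphere_measure"
proof -
  have "compact (shadow \<gamma> (cell k r ij))"
    unfolding cell_def by (intro compact_shadow continuous_curve compact_Times) auto
  then have "shadow \<gamma> (cell k r ij) \<in> sets borel" by (rule borel_compact)
  then show ?thesis
    by (simp add: sphere_measure_def sets_restrict_space_iff) (auto simp: shadow_def)
qed

lemma grid_count_measurable: "grid_count \<gamma> k r \<in> borel_measurable sphere_measure"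
  unfolding grid_count_def[abs_def] using shadow_in_sets by measurable

text \<open>
Here \<open>4 r + 1\<close> is the number of mesh steps in the window from \<open>a - h\<close> to \<open>a + s + h\<close>, and
\<open>2 r\<close> is the number of squares above each interval of positions. The bound does not depend
on the mesh, as Fatou's lemma requires.
\<close>

lemma nn_integral_grid_count:
  assumes r: "0 < r"
  shows "(\<integral>\<^sup>+\<sigma>. grid_count \<gamma> k r \<sigma> \<partial>sphere_measure) \<le> ennreal (144 * d^3 * (pi / 2 ^ k) * E / v\<^sup>2)"
proof -
  define s where "s = mesh k r"
  define h where "h = pi / 2 ^ k"
  define c where "c = 48 * d^3 / (v\<^sup>2 * h) * s\<^sup>2"
  define N where "N = 2 ^ Suc k * (2 * r)"
  define G where "G i = \<Psi> (- pi - h + real i * s)" for i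
  have s: "0 < s" using mesh_pos[OF r] by (simp add: s_def)
  have hs: "h = 2 * real r * s" using mesh_times[OF r] by (simp add: s_def h_def)
  have h: "0 < h" "h \<le> pi" by (auto simp: h_def divide_simps)
  have c: "0 \<le> c" using d_pos h by (simp add: c_def)
  have Ns: "real N * s = 2 * pi"
    using hs by (simp add: N_def h_def field_simps)
  have "G (i + N) = G i + E" for i
    using energy_period[of "- pi - h + real i * s"] Ns by (simp add: G_def algebra_simps)
  then have tele: "(\<Sum>i<N. G (i + (4 * r + 1)) - G i) = real (4 * r + 1) * E"
    by (rule sum_increments_quasiperiodic)
  have cell: "emeasure sphere_measure (shadow \<gamma> (cell k r (i, j)))
      \<le> ennreal (c * (G (i + (4 * r + 1)) - G i))" if ij: "(i, j) \<in> grid k r" for i j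
  proof -
    have "emeasure sphere_measure (shadow \<gamma> (cell k r (i, j)))
        \<le> ennreal (c * (\<Psi> (- pi + real i * s + s + h) - \<Psi> (- pi + real i * s - h)))"
      unfolding cell_def c_def s_def[symmetric] fst_conv snd_conv
      using grid_cell_distance[OF ij r] h s
      by (intro emeasure_shadow_rectangle) (auto simp: s_def h_def)
    also have "- pi + real i * s + s + h = - pi - h + real (i + (4 * r + 1)) * s"
      by (simp add: hs algebra_simps)
    also have "- pi + real i * s - h = - pi - h + real i * s" by simp
    finally show ?thesis by (simp add: G_def)
  qed
  have G_mono: "G i \<le> G (i + (4 * r + 1))" for i
    unfolding G_def using s by (intro energy_mono add_left_mono mult_right_mono) auto
  have "(\<integral>\<^sup>+\<sigma>. grid_count \<gamma> k r \<sigma> \<partial>sphere_measure) =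
      (\<Sum>ij\<in>grid k r. emeasure sphere_measure (shadow \<gamma> (cell k r ij)))"
    unfolding grid_count_def using shadow_in_sets by (subst nn_integral_sum) auto
  also have "\<dots> \<le> (\<Sum>ij\<in>grid k r. ennreal (c * (G (fst ij + (4 * r + 1)) - G (fst ij))))"
    using cell by (intro sum_mono) auto
  also have "\<dots> = ennreal (\<Sum>ij\<in>grid k r. c * (G (fst ij + (4 * r + 1)) - G (fst ij)))"
    using c G_mono by (intro sum_ennreal) auto
  also have "(\<Sum>ij\<in>grid k r. c * (G (fst ij + (4 * r + 1)) - G (fst ij))) =
      (\<Sum>i<N. \<Sum>j\<in>{int r..<2 * int r} \<union> {- 2 * int r..<- int r}. c * (G (i + (4 * r + 1)) - G i))"
    unfolding grid_def N_def sum.cartesian_product by (intro sum.cong) auto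
  also have "\<dots> = (\<Sum>i<N. 2 * real r * (c * (G (i + (4 * r + 1)) - G i)))"
    by (simp add: card_Un_disjoint)
  also have "\<dots> = 2 * real r * c * (real (4 * r + 1) * E)"
    unfolding tele[symmetric] by (simp add: sum_distrib_left mult.assoc)
  also have "\<dots> \<le> 2 * real r * c * (6 * real r * E)"
    using r c energy_nonneg by (intro mult_left_mono mult_right_mono) auto
  also have "\<dots> = 144 * d^3 * h * E / v\<^sup>2"
    using h s r v_pos by (simp add: c_def hs field_simps power2_eq_square)
  finally show ?thesis
    by (simp add: h_def ennreal_leI)
qed

text \<open>
On the annulus \<open>k\<close> the weight is at most \<open>(4 * 2 ^ k) powr p\<close>. An unconditional sum is the
supremum of its finite partial sums, and these may be sorted by annulus.
\<close>

lemma infsum_crossings_le: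
  assumes p: "0 \<le> p" and \<sigma>: "\<sigma> \<in> sphere 0 1"
    and w: "\<And>x z. z \<noteq> 0 \<Longrightarrow> \<bar>z\<bar> \<le> pi \<Longrightarrow> w (x, z) \<le> ennreal ((2 * pi / \<bar>z\<bar>) powr p)"
  shows "(\<Sum>\<^sub>\<infinity>q\<in>crossings \<gamma> \<sigma>. w q) \<le>
    (\<Sum>k. ennreal ((4 * 2 ^ k) powr p) * liminf (\<lambda>r. grid_count \<gamma> k r \<sigma>))"
    (is "_ \<le> (\<Sum>k. ?b k)")
proof (subst nonneg_infsum_complete, simp, rule SUP_least)
  fix F assume "F \<in> {F. finite F \<and> F \<subseteq> crossings \<gamma> \<sigma>}"
  then have F: "finite F" "F \<subseteq> crossings \<gamma> \<sigma>" by auto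
  have "\<forall>q\<in>F. \<exists>k. snd q \<in> dyadic_annulus k"
    using F(2) dyadic_annulus_exists by (fastforce simp: crossings_def)
  then obtain \<kappa> where \<kappa>: "\<And>q. q \<in> F \<Longrightarrow> snd q \<in> dyadic_annulus (\<kappa> q)" by metis
  have level: "sum w {q \<in> F. \<kappa> q = k} \<le> ?b k" for k
  proof -
    have "w q \<le> ennreal ((4 * 2 ^ k) powr p)" if q: "q \<in> F" "\<kappa> q = k" for q
    proof -
      obtain x z where xz: "q = (x, z)" by fastforce
      have hp: "0 < pi / 2 ^ k" "pi / 2 ^ k \<le> pi" by (auto simp: divide_simps)
      have z: "pi / 2 ^ k / 2 \<le> \<bar>z\<bar>" "\<bar>z\<bar> \<le> pi / 2 ^ k"
        using \<kappa>[OF q(1)] hp unfolding q(2) unfolding xz dyadic_annulus_def by auto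
      have "0 < \<bar>z\<bar>" using z(1) half_gt_zero[OF hp(1)] by linarith
      then have z0: "z \<noteq> 0" by simp
      have "2 * pi / \<bar>z\<bar> \<le> 2 * pi / (pi / 2 ^ k / 2)"
        using z half_gt_zero[OF hp(1)] by (intro frac_le) auto
      also have "\<dots> = 4 * 2 ^ k" by simp
      finally have "(2 * pi / \<bar>z\<bar>) powr p \<le> (4 * 2 ^ k) powr p"
        using p by (intro powr_mono2) auto
      moreover have "w q \<le> ennreal ((2 * pi / \<bar>z\<bar>) powr p)"
        unfolding xz using z z0 hp by (intro w) auto
      ultimately show ?thesis by (meson ennreal_leI order_trans)
    qed
    then have "sum w {q \<in> F. \<kappa> q = k} \<le> (\<Sum>q\<in>{q \<in> F. \<kappa> q = k}. ennreal ((4 * 2 ^ k) powr p))"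
      by (intro sum_mono) auto
    also have "\<dots> = ennreal ((4 * 2 ^ k) powr p) * of_nat (card {q \<in> F. \<kappa> q = k})"
      by (simp add: mult.commute)
    also have "\<dots> \<le> ?b k"
    proof (intro mult_left_mono card_crossings_le_liminf \<sigma>)
      show "z \<in> dyadic_annulus k" if "(x, z) \<in> {q \<in> F. \<kappa> q = k}" for x z
        using \<kappa>[of "(x, z)"] that by auto
    qed (use F in auto)
    finally show ?thesis .
  qed
  have "sum w F = (\<Sum>k\<in>\<kappa> ` F. sum w {q \<in> F. \<kappa> q = k})"
    using F(1) by (simp add: sum.group)
  also have "\<dots> \<le> (\<Sum>k\<in>\<kappa> ` F. ?b k)"
    by (intro sum_mono level)
  also have "\<dots> \<le> (\<Sum>k. ?b k)"
    using F(1) by (intro sum_le_suminf) auto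
  finally show "sum w F \<le> (\<Sum>k. ?b k)" .
qed

text \<open>
The annulus \<open>k\<close> contributes a constant times \<open>2 powr (k * p)\<close> from the weight and
\<open>1 / 2 ^ k\<close> from the measure of directions. The geometric series converges because \<open>p < 1\<close>.
\<close>

lemma nn_integral_crossings_le:
  assumes p: "0 \<le> p" "p < 1"
    and w: "\<And>x z. z \<noteq> 0 \<Longrightarrow> \<bar>z\<bar> \<le> pi \<Longrightarrow> w (x, z) \<le> ennreal ((2 * pi / \<bar>z\<bar>) powr p)"
  shows "(\<integral>\<^sup>+\<sigma>. (\<Sum>\<^sub>\<infinity>q\<in>crossings \<gamma> \<sigma>. w q) \<partial>sphere_measure) \<le>
    ennreal (144 * pi * 4 powr p / (1 - 2 powr p / 2) * (d^3 * E / v\<^sup>2))"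
proof -
  define A where "A = 144 * pi * 4 powr p * (d^3 * E / v\<^sup>2)"
  have A: "0 \<le> A"
    using d_pos energy_nonneg by (simp add: A_def)
  let ?c = "\<lambda>k. ennreal ((4 * 2 ^ k) powr p)"
  have meas: "(\<lambda>\<sigma>. liminf (\<lambda>r. grid_count \<gamma> k r \<sigma>)) \<in> borel_measurable sphere_measure" for k
    using grid_count_measurable by measurable
  have lim: "liminf (\<lambda>r. \<integral>\<^sup>+\<sigma>. grid_count \<gamma> k r \<sigma> \<partial>sphere_measure)
      \<le> ennreal (144 * d^3 * (pi / 2 ^ k) * E / v\<^sup>2)" for k
    by (rule order_trans[OF Liminf_le_Limsup Limsup_bounded])
       (simp, rule eventually_mono[OF eventually_gt_at_top[of 0]], erule nn_integral_grid_count)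
  have geo: "(\<lambda>k. A * (2 powr p / 2) ^ k) sums (A * (1 / (1 - 2 powr p / 2)))"
  proof (intro sums_mult geometric_sums)
    have "2 powr p < 2 powr 1" using p by (intro powr_less_mono) auto
    then show "norm (2 powr p / 2) < 1" by simp
  qed
  have "(\<integral>\<^sup>+\<sigma>. (\<Sum>\<^sub>\<infinity>q\<in>crossings \<gamma> \<sigma>. w q) \<partial>sphere_measure) \<le>
      (\<integral>\<^sup>+\<sigma>. (\<Sum>k. ?c k * liminf (\<lambda>r. grid_count \<gamma> k r \<sigma>)) \<partial>sphere_measure)"
    using p w by (intro nn_integral_mono infsum_crossings_le)
      (auto simp: sphere_measure_def space_scale_measure space_restrict_space)
  also have "\<dots> = (\<Sum>k. ?c k * (\<integral>\<^sup>+\<sigma>. liminf (\<lambda>r. grid_count \<gamma> k r \<sigma>) \<partial>sphere_measure))"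
    using meas by (simp add: nn_integral_suminf nn_integral_cmult)
  also have "\<dots> \<le> (\<Sum>k. ?c k * ennreal (144 * d^3 * (pi / 2 ^ k) * E / v\<^sup>2))"
    by (intro suminf_le mult_left_mono order_trans[OF nn_integral_liminf lim] grid_count_measurable) auto
  also have "\<dots> = (\<Sum>k. ennreal (A * (2 powr p / 2) ^ k))"
  proof (intro suminf_cong)
    fix k
    have "(4 * 2 ^ k) powr p = 4 powr p * (2 powr p) ^ k"
      by (simp add: powr_mult powr_powr flip: powr_realpow) (simp add: mult.commute)
    then have "(4 * 2 ^ k) powr p * (144 * d^3 * (pi / 2 ^ k) * E / v\<^sup>2) = A * (2 powr p / 2) ^ k"
      by (simp add: A_def power_divide mult_ac)
    then show "?c k * ennreal (144 * d^3 * (pi / 2 ^ k) * E / v\<^sup>2) = ennreal (A * (2 powr p / 2) ^ k)"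
      by (simp flip: ennreal_mult')
  qed
  also have "\<dots> = ennreal (A * (1 / (1 - 2 powr p / 2)))"
    using A geo by (intro suminf_ennreal_eq) auto
  finally show ?thesis by (simp add: A_def mult_ac)
qed

end

section \<open>Curves of finite distortion and finite bending energy\<close>

lemma deriv1_periodic:
  assumes "closed_curve f"
  shows "closed_curve (deriv1 f)"
proof -
  have shift: "((\<lambda>t. f (t + c)) has_vector_derivative D) (at x)"
    if "(f has_vector_derivative D) (at (x + c))" for c x D
  proof -
    have "((\<lambda>t. t + c) has_vector_derivative 1) (at x)"
      by (auto intro!: derivative_eq_intros)
    then show ?thesis
      using vector_diff_chain_at[of "\<lambda>t. t + c" 1 x f D] that by (simp add: o_def)
  qed
  have p: "f (x + 2 * pi) = f x" "f (x - 2 * pi) = f x" for x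
    using assms[unfolded closed_curve_def, rule_format, of x]
      assms[unfolded closed_curve_def, rule_format, of "x - 2 * pi"] by auto
  have "(f has_vector_derivative D) (at (x + 2 * pi)) \<longleftrightarrow> (f has_vector_derivative D) (at x)" for D x
    using shift[of D x "2 * pi"] shift[of D "x + 2 * pi" "- (2 * pi)"] p by auto
  then show ?thesis
    by (simp add: closed_curve_def deriv1_def vector_derivative_def)
qed

lemma closed_curve_of_int:
  assumes "closed_curve \<gamma>"
  shows "\<gamma> (x + 2 * pi * of_int k) = \<gamma> x"
proof -
  have nat: "\<gamma> (x + 2 * pi * real n) = \<gamma> x" for n x
  proof (induction n)
    case (Suc n)
    then show ?case
      using assms[unfolded closed_curve_def, rule_format, of "x + 2 * pi * real n"]
      by (simp add: algebra_simps)
  qed simp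
  show ?thesis
  proof (cases "0 \<le> k")
    case True
    then show ?thesis using nat[of x "nat k"] by simp
  next
    case False
    then show ?thesis using nat[of "x + 2 * pi * of_int k" "nat (- k)"] by simp
  qed
qed

lemma circle_dom_representative:
  obtains j :: int where "x + 2 * pi * of_int j \<in> circle_dom"
proof
  show "x + 2 * pi * of_int (- \<lfloor>(x + pi) / (2 * pi)\<rfloor>) \<in> circle_dom"
    using floor_divide_lower[of "2 * pi" "x + pi"] floor_divide_upper[of "2 * pi" "x + pi"]
    by (simp add: circle_dom_def algebra_simps)
qed

lemma abs_le_abs_add_period:
  assumes "\<bar>z\<bar> \<le> pi"
  shows "\<bar>z\<bar> \<le> \<bar>z + 2 * pi * of_int k\<bar>"
proof (cases "k = 0")
  case False
  then have "1 \<le> \<bar>real_of_int k\<bar>" by linarith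
  then have "2 * pi * 1 \<le> 2 * pi * \<bar>real_of_int k\<bar>"
    by (intro mult_left_mono) auto
  then have "2 * pi \<le> \<bar>2 * pi * of_int k\<bar>"
    by (simp add: abs_mult)
  then show ?thesis
    using assms by linarith
qed simp

lemma arc_dist_ge:
  assumes speed: "\<And>t. norm (deriv1 \<gamma> t) = v" and v: "0 \<le> v"
    and y: "y = x + z + 2 * pi * of_int l" and z: "\<bar>z\<bar> \<le> pi"
  shows "v * \<bar>z\<bar> \<le> arc_dist \<gamma> x y"
  unfolding arc_dist_def
proof (rule cINF_greatest)
  fix k :: int
  let ?t = "y + 2 * pi * of_int k"
  have "\<bar>z\<bar> \<le> \<bar>?t - x\<bar>"
    using abs_le_abs_add_period[OF z, of "l + k"] by (simp add: y algebra_simps)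
  also have "\<bar>?t - x\<bar> = max x ?t - min x ?t" by linarith
  finally have "v * \<bar>z\<bar> \<le> v * (max x ?t - min x ?t)"
    using v by (rule mult_left_mono)
  then show "v * \<bar>z\<bar> \<le> integral {min x ?t..max x ?t} (\<lambda>t. norm (deriv1 \<gamma> t))"
    using min.coboundedI1[OF max.cobounded1, of x ?t x]
    by (simp add: speed mult.commute min_le_iff_disj)
qed simp

text \<open>
Both points are moved to the fundamental domain, where the supremum defining the distortion is
taken. The points cannot coincide, since a quotient with denominator zero would be infinite.
\<close>

lemma distortion_chord:
  assumes closed: "closed_curve \<gamma>" and speed: "\<And>t. norm (deriv1 \<gamma> t) = v" and v: "0 < v"
    and fin: "distortion \<gamma> < \<infinity>" and z: "z \<noteq> 0" "\<bar>z\<bar> \<le> pi"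
  shows "v * \<bar>z\<bar> \<le> enn2real (distortion \<gamma>) * norm (\<gamma> (x + z) - \<gamma> x)"
proof -
  obtain j where j: "x + 2 * pi * of_int j \<in> circle_dom" (is "?x \<in> _")
    by (rule circle_dom_representative)
  obtain l where l: "x + z + 2 * pi * of_int l \<in> circle_dom" (is "?y \<in> _")
    by (rule circle_dom_representative)
  have y: "?y = ?x + z + 2 * pi * of_int (l - j)" by (simp add: algebra_simps)
  have arc: "v * \<bar>z\<bar> \<le> arc_dist \<gamma> ?x ?y"
    using arc_dist_ge[OF speed _ y z(2)] v by simp
  have "?x \<noteq> ?y"
    using abs_le_abs_add_period[OF z(2), of "l - j"] z(1) y by auto
  then have "ennreal (arc_dist \<gamma> ?x ?y) / ennreal (dist (\<gamma> ?x) (\<gamma> ?y)) \<le> distortion \<gamma>"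
    unfolding distortion_def using j l by (intro SUP_upper2[of "(?x, ?y)"]) auto
  then have le: "ennreal (arc_dist \<gamma> ?x ?y) / ennreal (norm (\<gamma> (x + z) - \<gamma> x)) \<le> distortion \<gamma>"
    by (simp add: closed_curve_of_int[OF closed] dist_norm norm_minus_commute)
  have pos: "0 < arc_dist \<gamma> ?x ?y" using arc v z(1) by (smt (verit) mult_pos_pos zero_less_abs_iff)
  define n where "n = norm (\<gamma> (x + z) - \<gamma> x)"
  have n: "0 < n"
  proof (rule ccontr)
    assume "\<not> 0 < n"
    then have "n = 0" by (simp add: n_def)
    then have "ennreal (arc_dist \<gamma> ?x ?y) / ennreal n = \<infinity>"
      using pos by (simp add: ennreal_divide_zero ennreal_zero_divide)
    then show False using le fin by (simp add: n_def)
  qed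
  have "ennreal (arc_dist \<gamma> ?x ?y / n) \<le> ennreal (enn2real (distortion \<gamma>))"
    using le pos n fin by (simp add: n_def divide_ennreal)
  then have "arc_dist \<gamma> ?x ?y / n \<le> enn2real (distortion \<gamma>)"
    by (simp add: ennreal_le_iff)
  then show ?thesis
    using arc n by (simp add: n_def[symmetric] pos_divide_le_eq)
qed

text \<open>
Positivity of the distortion follows from the chord inequality at any one pair of points.
\<close>

lemma energy_curve_exists:
  assumes closed: "closed_curve \<gamma>" and len: "curve_len \<gamma> > 0" and cs: "constant_speed \<gamma>"
    and fin: "distortion \<gamma> < \<infinity>" and bend: "finite_bending_energy \<gamma>"
  shows "\<exists>\<Psi>. energy_curve \<gamma> (deriv1 \<gamma>) \<Psi> (curve_len \<gamma> / (2 * pi)) (enn2real (distortion \<gamma>))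
    (integral {-pi..pi} (\<lambda>x. (norm (deriv2 \<gamma> x))\<^sup>2))"
proof -
  define v where "v = curve_len \<gamma> / (2 * pi)"
  let ?d = "enn2real (distortion \<gamma>)" and ?\<phi> = "\<lambda>x. (norm (deriv2 \<gamma> x))\<^sup>2"
  have v: "0 < v" using len by (simp add: v_def)
  have speed: "norm (deriv1 \<gamma> x) = v" for x
    using cs by (simp add: constant_speed_def v_def)
  have "closed_curve (deriv2 \<gamma>)"
    unfolding deriv2_def by (intro deriv1_periodic closed)
  then have per: "?\<phi> (x + 2 * pi) = ?\<phi> x" for x
    by (simp add: closed_curve_def)
  have int: "?\<phi> integrable_on {-pi..-pi + 2 * pi}"
    using bend by (simp add: finite_bending_energy_def)
  obtain \<Psi> where \<Psi>: "\<And>x y. x \<le> y \<Longrightarrow> \<Psi> y - \<Psi> x = integral {x..y} ?\<phi>"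
    "\<And>x. \<Psi> (x + 2 * pi) = \<Psi> x + integral {-pi..-pi + 2 * pi} ?\<phi>"
    using periodic_primitive_exists[of ?\<phi> "2 * pi" "-pi"] per int by auto
  have acc: "deriv2 \<gamma> absolutely_integrable_on {x..y}"
    "(deriv2 \<gamma> has_integral (deriv1 \<gamma> y - deriv1 \<gamma> x)) {x..y}" if "x \<le> y" for x y
    using bend that by (auto simp: finite_bending_energy_def loc_abs_cont_def deriv2_def)
  have chord: "v * \<bar>z\<bar> \<le> ?d * norm (\<gamma> (x + z) - \<gamma> x)" if "z \<noteq> 0" "\<bar>z\<bar> \<le> pi" for x z
    using distortion_chord[OF closed speed v fin that] .
  have "energy_curve \<gamma> (deriv1 \<gamma>) \<Psi> v ?d (integral {-pi..pi} ?\<phi>)"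
  proof
    show "(\<gamma> has_vector_derivative deriv1 \<gamma> x) (at x)" for x
      using bend by (simp add: finite_bending_energy_def deriv1_def vector_derivative_works)
    show "\<Psi> x \<le> \<Psi> y" if "x \<le> y" for x y
    proof -
      have "0 \<le> integral {x..y} ?\<phi>"
        using periodic_integrable_on[of ?\<phi> "2 * pi" "-pi"] per int by (intro integral_nonneg) auto
      then show ?thesis using \<Psi>(1)[OF that] by simp
    qed
    show "(norm (deriv1 \<gamma> y - deriv1 \<gamma> x))\<^sup>2 \<le> (y - x) * (\<Psi> y - \<Psi> x)" if "x \<le> y" for x y
    proof (cases "x = y")
      case False
      then have "(norm (integral {x..y} (deriv2 \<gamma>)))\<^sup>2 \<le> (y - x) * integral {x..y} ?\<phi>"
        using that periodic_integrable_on[of ?\<phi> "2 * pi" "-pi"] per int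
        by (intro norm_integral_cauchy_schwarz acc) auto
      then show ?thesis
        using acc(2)[OF that] \<Psi>(1)[OF that] by (simp add: integral_unique)
    qed simp
    show "0 < ?d"
    proof -
      have "0 < v * \<bar>1\<bar>" using v by simp
      also have "\<dots> \<le> ?d * norm (\<gamma> (0 + 1) - \<gamma> 0)"
        using pi_gt3 by (intro chord) auto
      finally show ?thesis by (simp add: zero_less_mult_iff)
    qed
  qed (use \<Psi>(2) speed v chord in auto)
  then show ?thesis unfolding v_def by blast
qed

text \<open>
For speed \<open>v\<close> the curvature is \<open>\<bar>\<gamma>''\<bar> / v\<^sup>2\<close>.
\<close>

lemma kappa_bar2_squared:
  assumes len: "curve_len \<gamma> > 0" and cs: "constant_speed \<gamma>"
  shows "2 * pi * (kappa_bar2 \<gamma>)\<^sup>2 =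
    integral {-pi..pi} (\<lambda>x. (norm (deriv2 \<gamma> x))\<^sup>2) / (curve_len \<gamma> / (2 * pi))\<^sup>2"
proof -
  define v where "v = curve_len \<gamma> / (2 * pi)"
  define E where "E = integral {-pi..pi} (\<lambda>x. (norm (deriv2 \<gamma> x))\<^sup>2)"
  have v: "0 < v" and L: "curve_len \<gamma> = 2 * pi * v" using len by (auto simp: v_def)
  have speed: "norm (deriv1 \<gamma> x) = v" for x
    using cs by (simp add: constant_speed_def v_def)
  have E: "0 \<le> E"
    unfolding E_def by (cases "(\<lambda>x. (norm (deriv2 \<gamma> x))\<^sup>2) integrable_on {-pi..pi}")
      (auto intro: integral_nonneg simp: not_integrable_integral)
  have "(curvature \<gamma> x)\<^sup>2 * norm (deriv1 \<gamma> x) = (1 / v^3) * (norm (deriv2 \<gamma> x))\<^sup>2" for x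
    using v by (simp add: curvature_def L speed field_simps eval_nat_numeral)
  then have "integral {-pi..pi} (\<lambda>x. (curvature \<gamma> x)\<^sup>2 * norm (deriv1 \<gamma> x)) = 1 / v^3 * E"
    by (simp add: E_def)
  then have "kappa_bar2 \<gamma> = v powr (1/2) * (1 / (2 * pi) * (1 / v^3 * E)) powr (1/2)"
    by (simp add: kappa_bar2_def v_def)
  then have "(kappa_bar2 \<gamma>)\<^sup>2 = v * (1 / (2 * pi) * (1 / v^3 * E))"
    using v E by (simp add: power_mult_distrib powr_half_sqrt)
  then show ?thesis
    unfolding E_def[symmetric] v_def[symmetric]
    using v by (simp add: field_simps eval_nat_numeral)
qed

theorem mainTheorem4:
  fixes p :: real
  assumes "0 \<le> p" and "p < 1"
  shows "\<exists>C::real. C > 0 \<and>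
    (\<forall>\<gamma> :: real \<Rightarrow> real^3.
       closed_curve \<gamma> \<longrightarrow> curve_len \<gamma> > 0 \<longrightarrow> constant_speed \<gamma> \<longrightarrow>
       distortion \<gamma> < \<infinity> \<longrightarrow> finite_bending_energy \<gamma> \<longrightarrow>
       weighted_crossing_number p \<gamma> \<le> ennreal (C * (kappa_bar2 \<gamma>)\<^sup>2) * (distortion \<gamma>) ^ 3)"
proof -
  define K where "K = 1 - 2 powr p / 2"
  \<comment> \<open>The factor 72 is 144 from the integral estimate, times \<open>2 pi\<close> from the normalisation of the bending energy, over \<open>4 pi\<close>.\<close>
  define C where "C = 72 * pi * 4 powr p / K"
  have "2 powr p < 2 powr 1" using assms by (intro powr_less_mono) auto
  then have K: "0 < K" by (simp add: K_def)
  then have C: "0 < C" by (simp add: C_def)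
  show ?thesis
  proof (intro exI[of _ C] conjI allI impI C)
    fix \<gamma> :: "real \<Rightarrow> real^3"
    assume closed: "closed_curve \<gamma>" and len: "curve_len \<gamma> > 0" and cs: "constant_speed \<gamma>"
      and fin: "distortion \<gamma> < \<infinity>" and bend: "finite_bending_energy \<gamma>"
    define v where "v = curve_len \<gamma> / (2 * pi)"
    define d where "d = enn2real (distortion \<gamma>)"
    define E where "E = integral {-pi..pi} (\<lambda>x. (norm (deriv2 \<gamma> x))\<^sup>2)"
    obtain \<Psi> where "energy_curve \<gamma> (deriv1 \<gamma>) \<Psi> v d E"
      unfolding v_def d_def E_def using energy_curve_exists[OF closed len cs fin bend] by blast
    then interpret energy_curve \<gamma> "deriv1 \<gamma>" \<Psi> v d E .
    define w where "w = (\<lambda>(x, z). ennreal ((curve_len \<gamma> / arc_dist \<gamma> x (x + z)) powr p))"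
    have w: "w (x, z) \<le> ennreal ((2 * pi / \<bar>z\<bar>) powr p)" if z: "z \<noteq> 0" "\<bar>z\<bar> \<le> pi" for x z
    proof -
      have "v * \<bar>z\<bar> \<le> arc_dist \<gamma> x (x + z)"
        using arc_dist_ge[of \<gamma> v "x + z" x z 0] speed v_pos z by simp
      moreover have vz: "0 < v * \<bar>z\<bar>" using v_pos z by simp
      ultimately have "curve_len \<gamma> / arc_dist \<gamma> x (x + z) \<le> curve_len \<gamma> / (v * \<bar>z\<bar>)"
        "0 \<le> curve_len \<gamma> / arc_dist \<gamma> x (x + z)"
        using len by (auto intro!: frac_le)
      moreover have "curve_len \<gamma> / (v * \<bar>z\<bar>) = 2 * pi / \<bar>z\<bar>"
        using len by (simp add: v_def)
      ultimately show ?thesis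
        using assms by (auto simp: w_def intro!: ennreal_leI powr_mono2)
    qed
    have "weighted_crossing_number p \<gamma> =
        ennreal (1 / (4 * pi)) * (\<integral>\<^sup>+\<sigma>. (\<Sum>\<^sub>\<infinity>q\<in>crossings \<gamma> \<sigma>. w q) \<partial>sphere_measure)"
      by (simp add: weighted_crossing_number_def w_def)
    also have "\<dots> \<le> ennreal (1 / (4 * pi)) *
        ennreal (144 * pi * 4 powr p / K * (d^3 * E / v\<^sup>2))"
      unfolding K_def using assms w by (intro mult_left_mono nn_integral_crossings_le) auto
    also have "\<dots> = ennreal (1 / (4 * pi) * (144 * pi * 4 powr p / K * (d^3 * E / v\<^sup>2)))"
      by (simp flip: ennreal_mult')
    also have "1 / (4 * pi) * (144 * pi * 4 powr p / K * (d^3 * E / v\<^sup>2)) =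
        C / (2 * pi) * (E / v\<^sup>2) * d^3"
      using K by (simp add: C_def field_simps)
    also have "E / v\<^sup>2 = 2 * pi * (kappa_bar2 \<gamma>)\<^sup>2"
      using kappa_bar2_squared[OF len cs] by (simp add: E_def v_def)
    also have "C / (2 * pi) * (2 * pi * (kappa_bar2 \<gamma>)\<^sup>2) * d^3 = C * (kappa_bar2 \<gamma>)\<^sup>2 * d^3"
      by simp
    also have "ennreal (C * (kappa_bar2 \<gamma>)\<^sup>2 * d^3) = ennreal (C * (kappa_bar2 \<gamma>)\<^sup>2) * ennreal d ^ 3"
      using C d_pos by (simp add: ennreal_mult ennreal_power)
    also have "ennreal d = distortion \<gamma>"
      using fin by (simp add: d_def)
    finally show "weighted_crossing_number p \<gamma> \<le> ennreal (C * (kappa_bar2 \<gamma>)\<^sup>2) * (distortion \<gamma>) ^ 3" .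
  qed
qed

end
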